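(* Let $\{\theta_k\}_{k=1}^\infty$ be an infinite sequence of rational multiples of $\pi$ from the interval $(0,\pi)$ such that $$d(\theta_k)\nmid\operatorname{lcm}(d(\theta_1),\dots,d(\theta_{k-1}))$$ for $k=2,3,\dots$. Set $E=\{\theta_k:\ k=1,2,\dots\}$ and define $\eta:E\to\mathbb{Z}^+$ by $\eta(\theta_1)=1$ and $$\eta(\theta_k)=\operatorname{lcm}(d(\theta_1),\dots,d(\theta_{k-1}))$$ for $k=2,3,\dots$. Then $(E,\eta)$ is an admissible function of angles.
   Context: $\mathbb{Z}^+=\{1,2,3,\dots\}$. For $\theta\in\mathbb{R}$ the set $\mathcal{I}(\theta)=\{m\in\mathbb{Z}:\sin(m\theta)=0\}$ is an ideal in $\mathbb{Z}$, and $d(\theta)\geq0$ denotes its unique non-negative generator: $\mathcal{I}(\theta)=d(\theta)\mathbb{Z}$. (Thus $d(\theta)=0$ iff $\theta$ is not a rational multiple of $\pi$, and $d(\frac rs\pi)=s$ if $r\in\mathbb{Z}$, $s\in\mathbb{Z}^+$ are relatively prime.) $\operatorname{lcm}$ denotes the least common multiple, i.e. the non-negative generator of the intersection of the ideals generated by the given integers. An admissible function of angles is a pair $(E,\eta)$ with $E\subset(0,\pi)$ a set and $\eta:E\to\mathbb{Z}^+$ a function such that for every $k\in\mathbb{Z}^+$ there exists $\theta\in E$ with $\sin(k\theta)\neq0$ and $k\geq\eta(\theta)$. *)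

theory Defs
  imports Complex_Main
begin

definition sin_ideal :: "real \<Rightarrow> int set" where
  "sin_ideal \<theta> = {m. sin (of_int m * \<theta>) = 0}"

definition d :: "real \<Rightarrow> nat" where
  "d \<theta> = (THE n. sin_ideal \<theta> = range (\<lambda>k. int n * k))"

lemma sin_ideal_generator: "\<exists>!n. sin_ideal \<theta> = range (\<lambda>k. int n * k)"
proof (rule ex_ex1I)
  have zero: "0 \<in> sin_ideal \<theta>"
    by (simp add: sin_ideal_def)
  have diff: "a - b \<in> sin_ideal \<theta>" if "a \<in> sin_ideal \<theta>" "b \<in> sin_ideal \<theta>" for a b
    using that by (simp add: sin_ideal_def left_diff_distrib sin_diff)
  have uminus: "- a \<in> sin_ideal \<theta>" if "a \<in> sin_ideal \<theta>" for a
    using that by (simp add: sin_ideal_def)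
  have nat_mult: "int k * a \<in> sin_ideal \<theta>" if "a \<in> sin_ideal \<theta>" for a k
  proof (induction k)
    case (Suc k)
    then show ?case
      using diff[OF Suc uminus[OF that]] by (simp add: algebra_simps)
  qed (simp add: zero)
  have mult: "a * k \<in> sin_ideal \<theta>" if "a \<in> sin_ideal \<theta>" for a k
  proof (cases k)
    case (nonneg n)
    then show ?thesis using nat_mult[OF that, of n] by (simp add: mult.commute)
  next
    case (neg n)
    then show ?thesis
      using uminus[OF nat_mult[OF that, of "Suc n"]] by (metis mult.commute mult_minus_left)
  qed
  show "\<exists>n. sin_ideal \<theta> = range (\<lambda>k. int n * k)"
  proof (cases "\<exists>n>0. int n \<in> sin_ideal \<theta>")
    case False
    have "a = 0" if "a \<in> sin_ideal \<theta>" for a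
    proof (rule ccontr)
      assume "a \<noteq> 0"
      moreover have "int (nat \<bar>a\<bar>) \<in> sin_ideal \<theta>"
        using that uminus[OF that] by (simp add: abs_if)
      ultimately show False using False by (metis zero_less_abs_iff zero_less_nat_eq)
    qed
    with zero have "sin_ideal \<theta> = range (\<lambda>k. int 0 * k)" by auto
    then show ?thesis by blast
  next
    case True
    define n where "n = (LEAST n. n > 0 \<and> int n \<in> sin_ideal \<theta>)"
    have n: "n > 0" "int n \<in> sin_ideal \<theta>"
      using LeastI_ex[OF True] by (auto simp: n_def)
    have "a \<in> range (\<lambda>k. int n * k)" if a: "a \<in> sin_ideal \<theta>" for a
    proof -
      have r: "int (nat (a mod int n)) \<in> sin_ideal \<theta>"
        using diff[OF a mult[OF n(2), of "a div int n"]] n(1)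
        by (simp add: minus_mult_div_eq_mod)
      have "nat (a mod int n) < n"
        using n(1) by (simp add: nat_less_iff)
      then have "nat (a mod int n) = 0"
        using not_less_Least[of "nat (a mod int n)" "\<lambda>n. n > 0 \<and> int n \<in> sin_ideal \<theta>"] r
        by (auto simp: n_def)
      then have "a mod int n = 0"
        using n(1) pos_mod_sign[of "int n" a] by linarith
      then show ?thesis by auto
    qed
    then have "sin_ideal \<theta> = range (\<lambda>k. int n * k)"
      using mult[OF n(2)] by blast
    then show ?thesis by blast
  qed
next
  fix n n'
  assume n: "sin_ideal \<theta> = range (\<lambda>k. int n * k)" and n': "sin_ideal \<theta> = range (\<lambda>k. int n' * k)"
  have "int n \<in> sin_ideal \<theta>" "int n' \<in> sin_ideal \<theta>"
    using rangeI[of "\<lambda>k. int n * k" 1] rangeI[of "\<lambda>k. int n' * k" 1] n n' by simp_all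
  then have "int n dvd int n'" "int n' dvd int n"
    using n n' by (auto simp: dvd_def)
  then show "n = n'" by (simp add: dvd_antisym)
qed

lemma sin_ideal_eq: "sin_ideal \<theta> = range (\<lambda>k. int (d \<theta>) * k)"
  unfolding d_def by (rule theI'[OF sin_ideal_generator])

definition admissible :: "real set \<Rightarrow> (real \<Rightarrow> nat) \<Rightarrow> bool" where
  "admissible E \<eta> \<longleftrightarrow>
     E \<subseteq> {0<..<pi} \<and> (\<forall>\<theta>\<in>E. \<eta> \<theta> \<ge> 1) \<and>
     (\<forall>k::nat. k \<ge> 1 \<longrightarrow> (\<exists>\<theta>\<in>E. sin (real k * \<theta>) \<noteq> 0 \<and> k \<ge> \<eta> \<theta>))"

text \<open>
  Sequences are indexed from 1; the value at index 0 is irrelevant.  The equations below only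
  constrain the values of \<open>\<eta>\<close> on \<open>E = \<theta> ` {1..}\<close>.  They define a function on \<open>E\<close> only if they are
  consistent when \<open>\<theta>\<close> takes a value more than once, so the existence of such an \<open>\<eta>\<close> is a claim
  to be proved and not a matter of definition.
\<close>

definition eta_equations :: "(nat \<Rightarrow> real) \<Rightarrow> (real \<Rightarrow> nat) \<Rightarrow> bool" where
  "eta_equations \<theta> \<eta> \<longleftrightarrow>
     \<eta> (\<theta> 1) = 1 \<and> (\<forall>k\<ge>2. \<eta> (\<theta> k) = Lcm ((\<lambda>j. d (\<theta> j)) ` {1..<k}))"

end

(* Put L k = lcm (d(theta_1), ..., d(theta_(k-1))).  As d(theta_k) never divides L k, the sequence L
   is strictly increasing for divisibility, hence unbounded.  So for given k >= 1 not every
   d(theta_n) divides k; for the least n where this fails, sin (k theta_n) is nonzero, while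
   L n divides k and hence is at most k. *)

theory Submission
  imports Defs
begin

text \<open>This carries every statement about sines over to divisibility, so that the rest is
  arithmetic of the numbers \<open>d (\<theta> k)\<close>.\<close>

lemma sin_mult_eq_0_iff_d_dvd: "sin (real m * \<theta>) = 0 \<longleftrightarrow> d \<theta> dvd m"
proof -
  have "sin (real m * \<theta>) = 0 \<longleftrightarrow> int m \<in> sin_ideal \<theta>"
    by (simp add: sin_ideal_def)
  also have "\<dots> \<longleftrightarrow> int (d \<theta>) dvd int m"
    by (auto simp: sin_ideal_eq dvd_def)
  finally show ?thesis by simp
qed

text \<open>A positive denominator of \<open>q\<close> turns \<theta> into an integer multiple of
  \<open>pi\<close>, so \<open>d \<theta>\<close> divides a positive integer and cannot be
  0.\<close>

lemma d_pos_if_rational_multiple: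
  assumes "q \<in> \<rat>" "\<theta> = q * pi"
  shows "d \<theta> > 0"
proof -
  obtain a b where ab: "b > 0" "q = of_int a / of_int b"
    using assms(1) by (rule Rats_cases')
  have "real (nat b) * \<theta> = of_int a * pi"
    using ab assms(2) by simp
  then have "d \<theta> dvd nat b"
    using sin_mult_eq_0_iff_d_dvd[of "nat b" \<theta>] by (simp add: sin_zero_iff_int2)
  then show ?thesis
    using ab(1) by (intro Nat.gr0I) auto
qed

text \<open>Each new term fails to divide the lcm so far and hence changes it. Since all terms are
  positive, the old lcm divides a positive new one, so the change is an increase by at least 1,
  starting from the empty lcm 1.\<close>

lemma less_Lcm_of_not_dvd_preceding:
  fixes f :: "nat \<Rightarrow> nat"
  assumes pos: "\<And>k. k \<ge> 1 \<Longrightarrow> f k > 0"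
    and ndvd: "\<And>k. k \<ge> 1 \<Longrightarrow> \<not> f k dvd Lcm (f ` {1..<k})"
  shows "n < Lcm (f ` {1..<Suc n})"
proof (induction n)
  case (Suc n)
  let ?L = "\<lambda>k. Lcm (f ` {1..<k})"
  have step: "?L (Suc (Suc n)) = lcm (f (Suc n)) (?L (Suc n))"
    by (simp add: atLeastLessThanSuc)
  have "?L (Suc n) \<noteq> ?L (Suc (Suc n))"
  proof
    assume "?L (Suc n) = ?L (Suc (Suc n))"
    then have "f (Suc n) dvd ?L (Suc n)"
      unfolding step by (metis dvd_lcm1)
    with ndvd[of "Suc n"] show False by simp
  qed
  moreover have "?L (Suc n) \<le> ?L (Suc (Suc n))"
    using Suc pos[of "Suc n"] unfolding step by (intro dvd_imp_le) (auto intro!: lcm_pos_nat)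
  ultimately show ?case
    using Suc by linarith
qed simp

text \<open>For \<open>f j = d (\<theta> j)\<close> this is the last condition of admissibility,
  with the nonvanishing sine read as non-divisibility.\<close>

lemma ex_not_dvd_Lcm_le:
  fixes f :: "nat \<Rightarrow> nat"
  assumes pos: "\<And>k. k \<ge> 1 \<Longrightarrow> f k > 0"
    and ndvd: "\<And>k. k \<ge> 1 \<Longrightarrow> \<not> f k dvd Lcm (f ` {1..<k})"
    and "m \<ge> 1"
  shows "\<exists>n\<ge>1. \<not> f n dvd m \<and> Lcm (f ` {1..<n}) \<le> m"
proof -
  have "\<exists>n. n \<ge> 1 \<and> \<not> f n dvd m"
  proof (rule ccontr)
    assume "\<not> ?thesis"
    \<comment> \<open>The first \<open>m\<close> terms suffice for a contradiction: their lcm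
      already exceeds \<open>m\<close>.\<close>
    then have "Lcm (f ` {1..<Suc m}) dvd m"
      by (intro Lcm_least) auto
    then have "Lcm (f ` {1..<Suc m}) \<le> m"
      using \<open>m \<ge> 1\<close> by (intro dvd_imp_le) auto
    with less_Lcm_of_not_dvd_preceding[OF pos ndvd, of m] show False
      by simp
  qed
  then obtain n where n: "n \<ge> 1" "\<not> f n dvd m" "\<And>j. j < n \<Longrightarrow> \<not> (j \<ge> 1 \<and> \<not> f j dvd m)"
    unfolding exists_least_iff[of "\<lambda>n. n \<ge> 1 \<and> \<not> f n dvd m"] by blast
  have "Lcm (f ` {1..<n}) dvd m"
    using n(3) by (intro Lcm_least) auto
  then have "Lcm (f ` {1..<n}) \<le> m"
    using \<open>m \<ge> 1\<close> by (intro dvd_imp_le) auto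
  with n show ?thesis by blast
qed

theorem theorem9p1:
  fixes \<theta> :: "nat \<Rightarrow> real"
  assumes "\<And>k. k \<ge> 1 \<Longrightarrow> \<theta> k \<in> {0<..<pi}"
    and "\<And>k. k \<ge> 1 \<Longrightarrow> \<exists>q\<in>\<rat>. \<theta> k = q * pi"
    and "\<And>k. k \<ge> 2 \<Longrightarrow> \<not> d (\<theta> k) dvd Lcm ((\<lambda>j. d (\<theta> j)) ` {1..<k})"
  shows "(\<exists>\<eta>. eta_equations \<theta> \<eta>) \<and>
         (\<forall>\<eta>. eta_equations \<theta> \<eta> \<longrightarrow> admissible (\<theta> ` {1..}) \<eta>)"
proof -
  define L where "L k = Lcm ((\<lambda>j. d (\<theta> j)) ` {1..<k})" for k
  have pos: "d (\<theta> k) > 0" if "k \<ge> 1" for k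
    using assms(2)[OF that] d_pos_if_rational_multiple by blast
  have ndvd: "\<not> d (\<theta> k) dvd L k" if "k \<ge> 1" for k
  proof (cases "k = 1")
    case True
    \<comment> \<open>As \<open>L 1\<close> is the empty lcm 1, the claim says that
      \<open>d (\<theta> 1)\<close> is not 1, that is, \<open>sin (\<theta> 1)\<close> is
      nonzero.\<close>
    have "sin (\<theta> 1) > 0"
      using assms(1)[of 1] by (intro sin_gt_zero) auto
    then show ?thesis
      using sin_mult_eq_0_iff_d_dvd[of 1 "\<theta> 1"] True by (simp add: L_def)
  next
    case False
    then show ?thesis
      using assms(3)[of k] that by (simp add: L_def)
  qed
  \<comment> \<open>The separately prescribed value 1 at \<open>\<theta> 1\<close> is the empty lcm,
    so one formula covers all indices.\<close>
  have eqs: "eta_equations \<theta> \<eta> \<longleftrightarrow> (\<forall>k\<ge>1. \<eta> (\<theta> k) = L k)" for \<eta>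
  proof -
    have "L 1 = 1" by (simp add: L_def)
    moreover have "k \<ge> 1 \<longleftrightarrow> k = 1 \<or> k \<ge> 2" for k :: nat by auto
    ultimately show ?thesis
      unfolding eta_equations_def L_def[symmetric] by auto
  qed
  \<comment> \<open>Injectivity makes the equations for \<eta> consistent: if
    \<open>\<theta> i = \<theta> j\<close> with \<open>i < j\<close>, then
    \<open>d (\<theta> j)\<close> would be among the numbers whose lcm is \<open>L j\<close>. The
    witness for \<eta> can then recover the index from the angle.\<close>
  have inj: "inj_on \<theta> {1..}"
  proof (rule linorder_inj_onI)
    fix i j :: nat
    assume "i < j" "i \<in> {1..}" "j \<in> {1..}"
    then have "d (\<theta> i) dvd L j"
      unfolding L_def by (intro dvd_Lcm) auto
    with ndvd[of j] \<open>j \<in> {1..}\<close> show "\<theta> i \<noteq> \<theta> j" by auto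
  qed auto
  have "eta_equations \<theta> (\<lambda>t. L (inv_into {1..} \<theta> t))"
    unfolding eqs using inv_into_f_f[OF inj] by simp
  moreover have "admissible (\<theta> ` {1..}) \<eta>" if "eta_equations \<theta> \<eta>" for \<eta>
    unfolding admissible_def
  proof (intro conjI allI impI)
    have \<eta>: "\<eta> (\<theta> k) = L k" if "k \<ge> 1" for k
      using \<open>eta_equations \<theta> \<eta>\<close> that unfolding eqs by blast
    show "\<theta> ` {1..} \<subseteq> {0<..<pi}"
      using assms(1) by blast
    \<comment> \<open>Finiteness of the index range matters besides positivity: \<open>Lcm\<close>
      of an infinite set of naturals is 0.\<close>
    have "L k \<ge> 1" for k
    proof -
      have "0 \<notin> (\<lambda>j. d (\<theta> j)) ` {1..<k}"
        using pos by force
      then have "L k \<noteq> 0"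
        unfolding L_def by (subst Lcm_0_iff) auto
      then show ?thesis by simp
    qed
    then show "\<forall>t\<in>\<theta> ` {1..}. \<eta> t \<ge> 1"
      using \<eta> by auto
    fix m :: nat
    assume "m \<ge> 1"
    then obtain n where "n \<ge> 1" "\<not> d (\<theta> n) dvd m" "L n \<le> m"
      using ex_not_dvd_Lcm_le[of "\<lambda>j. d (\<theta> j)" m] pos ndvd unfolding L_def by blast
    then show "\<exists>t\<in>\<theta> ` {1..}. sin (real m * t) \<noteq> 0 \<and> m \<ge> \<eta> t"
      using \<eta> by (auto simp: sin_mult_eq_0_iff_d_dvd)
  qed
  ultimately show ?thesis by blast
qed

end
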